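(* Let $\mu_1,\mu_2,\mu_3,\mu_4$ be nonzero real numbers, and suppose that a configuration (critical point of $V$) of the $(1+4)$-vortex problem with these circulation parameters is a kite. Then the two infinitesimal vortices that are not on the line of symmetry have equal circulation parameters.
   Context: The $(1+4)$-vortex problem: a dominant vortex of circulation $1$ is at the origin, and four infinitesimal vortices $v_1,v_2,v_3,v_4$ with circulation parameters $\mu_i\in\mathbb{R}\setminus\{0\}$ lie on the unit circle, $v_i$ being at the point with polar coordinates $(1,\theta_i)$. Vortices do not collide, so the angles $\theta_i$ are pairwise distinct modulo $2\pi$. Define $$V(\theta)=-\sum_{1\le i<j\le 4}\mu_i\mu_j\left[\cos(\theta_i-\theta_j)+\tfrac12\log\bigl(2-2\cos(\theta_i-\theta_j)\bigr)\right].$$ A configuration of the $(1+4)$-vortex problem with circulation parameters $(\mu_1,\dots,\mu_4)$ means a critical point $\theta=(\theta_1,\dots,\theta_4)$ of $V$. A configuration is a kite if there is a line through the origin containing exactly two of the four infinitesimal vortices (which are therefore antipodal on the unit circle) such that the other two infinitesimal vortices are interchanged by reflection over this line; this line is the line of symmetry. *)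

theory Defs
  imports "HOL-Analysis.Analysis"
begin

text \<open>
  Angles and circulations are vectors indexed by the four-element type \<open>4\<close>, whose elements are
  ordered as \<open>0 < 1 < 2 < 3\<close> (so \<open>4 = 0\<close>); the sum over \<open>i < j\<close> therefore has one summand for
  each unordered pair of vortices.
\<close>

definition vortex_potential :: "real ^ 4 \<Rightarrow> real ^ 4 \<Rightarrow> real" where
  "vortex_potential \<mu> \<theta> =
     - (\<Sum>(i, j) \<in> {(i, j). i < j}. \<mu> $ i * \<mu> $ j *
          (cos (\<theta> $ i - \<theta> $ j) + 1 / 2 * ln (2 - 2 * cos (\<theta> $ i - \<theta> $ j))))"

text \<open>
  Since \<open>ln 0 = 0\<close>, the potential is total; the absence of collisions has to be required explicitly.
\<close>

definition collision_free :: "real ^ 4 \<Rightarrow> bool" where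
  "collision_free \<theta> \<longleftrightarrow>
     (\<forall>i j. i \<noteq> j \<longrightarrow> (\<forall>m::int. \<theta> $ i - \<theta> $ j \<noteq> 2 * pi * of_int m))"

definition vortex_configuration :: "real ^ 4 \<Rightarrow> real ^ 4 \<Rightarrow> bool" where
  "vortex_configuration \<mu> \<theta> \<longleftrightarrow>
     collision_free \<theta> \<and> (vortex_potential \<mu> has_derivative (\<lambda>_. 0)) (at \<theta>)"

definition vortex_position :: "real ^ 4 \<Rightarrow> 4 \<Rightarrow> complex" where
  "vortex_position \<theta> i = cis (\<theta> $ i)"

text \<open>Orthogonal reflection of the plane over the line spanned by a nonzero \<open>u\<close>.\<close>

definition line_reflection :: "complex \<Rightarrow> complex \<Rightarrow> complex" where
  "line_reflection u z = (2 * (z \<bullet> u) / (u \<bullet> u)) *\<^sub>R u - z"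

text \<open>
  The condition on \<open>k\<close> and \<open>l\<close> is symmetric, so it says that the two vortices off the line \<open>L\<close> are
  mapped to each other. A configuration is a kite iff it has such a line; the line is kept as an
  argument because a configuration (e.g. a square) may have more than one.
\<close>

definition kite_with_symmetry_line :: "real ^ 4 \<Rightarrow> complex set \<Rightarrow> bool" where
  "kite_with_symmetry_line \<theta> L \<longleftrightarrow>
     (\<exists>u. u \<noteq> 0 \<and> L = span {u} \<and>
          card {i. vortex_position \<theta> i \<in> L} = 2 \<and>
          (\<forall>k l. k \<noteq> l \<and> vortex_position \<theta> k \<notin> L \<and> vortex_position \<theta> l \<notin> L \<longrightarrow>
             line_reflection u (vortex_position \<theta> k) = vortex_position \<theta> l))"

end

theory Submission
  imports Defs
begin

text \<open>
  Write \<open>z\<^sub>i\<close> for the position of the vortex \<open>i\<close>. The partial derivative of the potential in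
  \<open>\<theta>\<^sub>p\<close> is, up to the factor \<open>- \<mu>\<^sub>p\<close>, the sum of \<open>\<mu>\<^sub>j D(z\<^sub>p z\<^sub>j\<^sup>*)\<close> over \<open>j \<noteq> p\<close>, where \<open>D w\<close>
  (\<open>pair_force\<close>), for \<open>w \<noteq> 1\<close> on the unit circle, is the derivative of \<open>cos x + ln (2 - 2 cos x) / 2\<close> at the argument \<open>x\<close>
  of \<open>w\<close> (lemma \<open>force_balance\<close>). The function \<open>D\<close> is odd under complex conjugation and vanishes
  at \<open>-1\<close>.

  Let \<open>p\<close> and \<open>q\<close> be the vortices on the line of symmetry and \<open>w = z\<^sub>p z\<^sub>k\<^sup>*\<close>. Since \<open>z\<^sub>q = - z\<^sub>p\<close>, the
  balance at \<open>p\<close> contains no contribution of \<open>q\<close>, and vice versa. The reflection makes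
  \<open>z\<^sub>p z\<^sub>l\<^sup>* = w\<^sup>*\<close>, so the two balances are \<open>(\<mu>\<^sub>k - \<mu>\<^sub>l) D(w) = 0\<close> and
  \<open>(\<mu>\<^sub>k - \<mu>\<^sub>l) D(- w) = 0\<close>. The zeros of \<open>D\<close> off the real axis have real part \<open>1/2\<close>, and therefore
  \<open>D(w)\<close> and \<open>D(- w)\<close> cannot both vanish.
\<close>

definition pair_force :: "complex \<Rightarrow> real" where
  "pair_force w = Im w * (1 / (2 - 2 * Re w) - 1)"

lemma pair_force_cnj: "pair_force (cnj w) = - pair_force w"
  by (simp add: pair_force_def)

lemma pair_force_real: "pair_force (complex_of_real r) = 0"
  by (simp add: pair_force_def)

text \<open>
  A zero off the real axis forces \<open>Re w = 1/2\<close>, which excludes the same for \<open>- w\<close>.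
\<close>

lemma pair_force_antipodal_nonzero:
  assumes "Im w \<noteq> 0"
  shows "pair_force w \<noteq> 0 \<or> pair_force (- w) \<noteq> 0"
proof (rule ccontr)
  assume "\<not> ?thesis"
  then have "1 / (2 - 2 * Re w) = 1" "1 / (2 + 2 * Re w) = 1"
    using assms by (auto simp: pair_force_def)
  then have "2 - 2 * Re w = 1" "2 + 2 * Re w = 1"
    by (metis div_by_1 divide_divide_eq_right mult_1)+
  then show False by simp
qed

lemma pair_potential_has_derivative:
  assumes "cos x \<noteq> 1"
  shows "((\<lambda>x. cos x + 1 / 2 * ln (2 - 2 * cos x)) has_real_derivative pair_force (cis x)) (at x)"
proof -
  have "2 - 2 * cos x > 0"
    using assms cos_le_one[of x] by linarith
  then show ?thesis
    by (auto intro!: derivative_eq_intros simp: pair_force_def field_simps)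
qed

text \<open>
  Each unordered pair \<open>{i, j}\<close> contributes \<open>A i j\<close> to \<open>i\<close> and \<open>A j i = - A i j\<close> to \<open>j\<close>, so together
  the contributions run over all ordered pairs of distinct indices.
\<close>

lemma sum_ordered_pairs_antisym:
  fixes A :: "'i::{finite,linorder} \<Rightarrow> 'i \<Rightarrow> real"
  assumes antisym: "\<And>i j. A j i = - A i j"
  shows "(\<Sum>(i, j)\<in>{(i, j). i < j}. A i j * (of_bool (i = p) - of_bool (j = p))) =
    (\<Sum>j\<in>UNIV - {p}. A p j)"
proof -
  define B where "B = (\<lambda>(i, j). A i j * of_bool (i = p))"
  have swap: "(\<Sum>(i, j)\<in>{(i, j). i < j}. B (j, i)) = (\<Sum>ij\<in>{(i, j). j < i}. B ij)"
    by (rule sum.reindex_bij_witness[of _ prod.swap prod.swap]) auto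
  have pairs: "{(i, j). i < j} \<union> {(i, j). j < i} = (SIGMA i:(UNIV :: 'i set). UNIV - {i})"
    by auto
  have "(\<Sum>(i, j)\<in>{(i, j). i < j}. A i j * (of_bool (i = p) - of_bool (j = p))) =
      (\<Sum>(i, j)\<in>{(i, j). i < j}. B (i, j) + B (j, i))"
  proof (rule sum.cong[OF refl], clarify)
    fix i j :: 'i
    show "A i j * (of_bool (i = p) - of_bool (j = p)) = B (i, j) + B (j, i)"
      using antisym[of i j] by (simp add: B_def algebra_simps)
  qed
  also have "\<dots> = (\<Sum>ij\<in>{(i, j). i < j}. B ij) + (\<Sum>ij\<in>{(i, j). j < i}. B ij)"
    unfolding swap[symmetric] by (simp add: split_def sum.distrib)
  also have "\<dots> = (\<Sum>ij\<in>(SIGMA i:(UNIV :: 'i set). UNIV - {i}). B ij)"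
    unfolding pairs[symmetric] by (rule sum.union_disjoint[symmetric]) auto
  also have "\<dots> = (\<Sum>i\<in>UNIV. \<Sum>j\<in>UNIV - {i}. B (i, j))"
    by (simp add: sum.Sigma split_def)
  also have "\<dots> = (\<Sum>i\<in>UNIV. if i = p then \<Sum>j\<in>UNIV - {p}. A p j else 0)"
    by (rule sum.cong) (auto simp: B_def)
  also have "\<dots> = (\<Sum>j\<in>UNIV - {p}. A p j)"
    by simp
  finally show ?thesis .
qed

lemma position_mult_cnj:
  "vortex_position \<theta> i * cnj (vortex_position \<theta> j) = cis (\<theta> $ i - \<theta> $ j)"
  by (simp add: vortex_position_def cis_cnj cis_mult)

lemma collision_free_cos_neq_1:
  assumes "collision_free \<theta>" "i \<noteq> j"
  shows "cos (\<theta> $ i - \<theta> $ j) \<noteq> 1"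
proof
  assume "cos (\<theta> $ i - \<theta> $ j) = 1"
  then obtain m :: int where "\<theta> $ i - \<theta> $ j = of_int m * 2 * pi"
    by (auto simp: cos_one_2pi_int)
  then have "\<theta> $ i - \<theta> $ j = 2 * pi * of_int m"
    by simp
  with assms show False
    unfolding collision_free_def by blast
qed

lemma inj_vortex_position:
  assumes "collision_free \<theta>"
  shows "inj (vortex_position \<theta>)"
proof (rule injI, rule ccontr)
  fix i j
  assume eq: "vortex_position \<theta> i = vortex_position \<theta> j" and "i \<noteq> j"
  have "cis (\<theta> $ i - \<theta> $ j) = vortex_position \<theta> j * cnj (vortex_position \<theta> j)"
    using position_mult_cnj[of \<theta> i j] eq by simp
  also have "\<dots> = 1"
    by (simp add: position_mult_cnj)
  finally have "cis (\<theta> $ i - \<theta> $ j) = 1" .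
  then have "cos (\<theta> $ i - \<theta> $ j) = 1"
    by (simp add: complex_eq_iff)
  with collision_free_cos_neq_1[OF assms \<open>i \<noteq> j\<close>] show False ..
qed

text \<open>
  This is the vanishing of the partial derivative of the potential in the \<open>p\<close>-th angle, divided by
  \<open>- \<mu> $ p\<close>.
\<close>

lemma force_balance:
  assumes conf: "vortex_configuration \<mu> \<theta>" and nonzero: "\<mu> $ p \<noteq> 0"
  shows "(\<Sum>j\<in>UNIV - {p}.
    \<mu> $ j * pair_force (vortex_position \<theta> p * cnj (vortex_position \<theta> j))) = 0"
proof -
  define \<phi> where "\<phi> = (\<lambda>s. \<theta> + s *\<^sub>R axis p 1)"
  define A where "A i j = \<mu> $ i * \<mu> $ j * pair_force (cis (\<theta> $ i - \<theta> $ j))" for i j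
  have cf: "collision_free \<theta>"
    and crit: "(vortex_potential \<mu> has_derivative (\<lambda>_. 0)) (at \<theta>)"
    using conf by (simp_all add: vortex_configuration_def)
  have diff: "\<phi> s $ i - \<phi> s $ j =
      \<theta> $ i - \<theta> $ j + s * (of_bool (i = p) - of_bool (j = p))" for s i j
    by (simp add: \<phi>_def axis_def algebra_simps of_bool_def)
  have "(\<phi> has_derivative (\<lambda>s. s *\<^sub>R axis p 1)) (at 0)"
    unfolding \<phi>_def by (auto intro!: derivative_eq_intros)
  moreover have "(vortex_potential \<mu> has_derivative (\<lambda>_. 0)) (at (\<phi> 0))"
    using crit by (simp add: \<phi>_def)
  ultimately have "((\<lambda>s. vortex_potential \<mu> (\<phi> s)) has_derivative (\<lambda>_. 0)) (at 0)"
    by (rule has_derivative_compose)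
  then have stationary: "((\<lambda>s. vortex_potential \<mu> (\<phi> s)) has_real_derivative 0) (at 0)"
    by (rule has_derivative_imp_has_field_derivative) simp
  have pair: "((\<lambda>s. \<mu> $ i * \<mu> $ j * (cos (\<phi> s $ i - \<phi> s $ j) +
        1 / 2 * ln (2 - 2 * cos (\<phi> s $ i - \<phi> s $ j)))) has_real_derivative
      A i j * (of_bool (i = p) - of_bool (j = p))) (at 0)" if "i < j" for i j
  proof -
    let ?d = "of_bool (i = p) - of_bool (j = p) :: real"
    have outer: "((\<lambda>x. cos x + 1 / 2 * ln (2 - 2 * cos x)) has_real_derivative
        pair_force (cis (\<theta> $ i - \<theta> $ j))) (at (\<theta> $ i - \<theta> $ j + 0 * ?d))"
      using pair_potential_has_derivative collision_free_cos_neq_1[OF cf] that by simp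
    have inner: "((\<lambda>s. \<theta> $ i - \<theta> $ j + s * ?d) has_real_derivative ?d) (at 0)"
      by (auto intro!: derivative_eq_intros)
    show ?thesis
      unfolding diff A_def mult.assoc
      using DERIV_cmult[OF DERIV_cmult[OF DERIV_chain2[OF outer inner]]] by simp
  qed
  have "((\<lambda>s. vortex_potential \<mu> (\<phi> s)) has_real_derivative
      - (\<Sum>(i, j)\<in>{(i, j). i < j}. A i j * (of_bool (i = p) - of_bool (j = p)))) (at 0)"
    unfolding vortex_potential_def split_def
    by (intro DERIV_minus DERIV_sum pair) auto
  with stationary have zero: "(\<Sum>(i, j)\<in>{(i, j). i < j}.
      A i j * (of_bool (i = p) - of_bool (j = p))) = 0"
    using DERIV_unique by fastforce
  have antisym: "A j i = - A i j" for i j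
    using pair_force_cnj[of "cis (\<theta> $ i - \<theta> $ j)"] by (simp add: A_def cis_cnj)
  have "(\<Sum>j\<in>UNIV - {p}. A p j) = 0"
    using zero unfolding sum_ordered_pairs_antisym[of A p, OF antisym] .
  then have "\<mu> $ p * (\<Sum>j\<in>UNIV - {p}. \<mu> $ j * pair_force (cis (\<theta> $ p - \<theta> $ j))) = 0"
    by (simp add: A_def sum_distrib_left mult.assoc)
  with nonzero show ?thesis
    by (simp add: position_mult_cnj)
qed

text \<open>
  Relative to a unit vector \<open>v\<close> on the line, the reflection is complex conjugation.
\<close>

lemma line_reflection_relative:
  assumes "v \<in> span {u}" "norm v = 1"
  shows "v * cnj (line_reflection u z) = cnj (v * cnj z)"
proof -
  obtain c where v: "v = c *\<^sub>R u"
    using assms(1) by (auto simp: span_singleton)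
  with assms(2) have "c \<noteq> 0" "u \<noteq> 0"
    by auto
  then have "line_reflection u z = line_reflection v z"
    by (simp add: line_reflection_def v divide_simps)
  also have "\<dots> = (2 * (z \<bullet> v)) *\<^sub>R v - z"
    using assms(2) by (simp add: line_reflection_def dot_square_norm)
  finally have refl: "line_reflection u z = (2 * (z \<bullet> v)) *\<^sub>R v - z" .
  have "v * cnj v = 1"
    using assms(2) by (simp add: complex_norm_square[symmetric])
  then have "v * cnj (line_reflection u z) = of_real (2 * (z \<bullet> v)) - v * cnj z"
    unfolding refl by (simp add: scaleR_conv_of_real algebra_simps)
  also have "\<dots> = cnj (v * cnj z)"
    by (simp add: complex_eq_iff inner_complex_def algebra_simps)
  finally show ?thesis .
qed

lemma unit_vectors_on_line_antipodal:
  fixes v v' :: complex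
  assumes "v \<in> span {u}" "v' \<in> span {u}" "norm v = 1" "norm v' = 1" "v \<noteq> v'"
  shows "v' = - v"
proof -
  obtain c d where v: "v = c *\<^sub>R u" "v' = d *\<^sub>R u"
    using assms(1,2) by (auto simp: span_singleton)
  then have "\<bar>c\<bar> * norm u = \<bar>d\<bar> * norm u" "norm u \<noteq> 0"
    using assms(3,4) by auto
  then have "\<bar>c\<bar> = \<bar>d\<bar>"
    by simp
  with v assms(5) show ?thesis
    by (auto simp: abs_eq_iff)
qed

theorem theorem10:
  fixes \<mu> \<theta> :: "real ^ 4" and L :: "complex set" and k l :: 4
  assumes "\<And>i. \<mu> $ i \<noteq> 0"
    and "vortex_configuration \<mu> \<theta>"
    and "kite_with_symmetry_line \<theta> L"
    and "k \<noteq> l"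
    and "vortex_position \<theta> k \<notin> L"
    and "vortex_position \<theta> l \<notin> L"
  shows "\<mu> $ k = \<mu> $ l"
proof -
  let ?z = "vortex_position \<theta>"
  have unit: "norm (?z i) = 1" for i
    by (simp add: vortex_position_def)
  obtain u where L: "L = span {u}" and two: "card {i. ?z i \<in> L} = 2"
    and refl: "line_reflection u (?z k) = ?z l"
    using assms(3-6) unfolding kite_with_symmetry_line_def by blast
  obtain p q where pq: "{i. ?z i \<in> L} = {p, q}" "p \<noteq> q"
    using two by (auto simp: card_2_iff)
  then have on_line: "?z p \<in> span {u}" "?z q \<in> span {u}"
    using L by auto
  have distinct: "k \<noteq> p" "k \<noteq> q" "l \<noteq> p" "l \<noteq> q"
    using pq assms(5,6) by auto
  have "{p, q, k, l} = UNIV"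
    by (rule card_subset_eq) (use pq(2) distinct assms(4) in auto)
  then have others: "UNIV - {p} = {q, k, l}" "UNIV - {q} = {p, k, l}"
    using pq(2) distinct by blast+
  have "?z p \<noteq> ?z q"
    using inj_vortex_position assms(2) pq(2) by (auto simp: vortex_configuration_def dest: injD)
  then have q: "?z q = - ?z p"
    using unit_vectors_on_line_antipodal on_line unit by blast
  define w where "w = ?z p * cnj (?z k)"
  have l: "?z p * cnj (?z l) = cnj w"
    using line_reflection_relative[OF on_line(1) unit, of "?z k"] refl by (simp add: w_def)
  have pp: "?z p * cnj (?z p) = 1"
    by (simp add: position_mult_cnj)
  have opposite: "pair_force (- 1) = 0"
    using pair_force_real[of "- 1"] by simp
  have "\<mu> $ k * pair_force w + \<mu> $ l * pair_force (cnj w) = 0"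
    using force_balance[OF assms(2,1), of p] distinct assms(4)
    by (simp add: others q pp l opposite w_def[symmetric])
  then have at_p: "(\<mu> $ k - \<mu> $ l) * pair_force w = 0"
    by (simp add: pair_force_cnj algebra_simps)
  have "\<mu> $ k * pair_force (- w) + \<mu> $ l * pair_force (cnj (- w)) = 0"
    using force_balance[OF assms(2,1), of q] distinct assms(4)
    by (simp add: others q pp l opposite w_def[symmetric])
  then have at_q: "(\<mu> $ k - \<mu> $ l) * pair_force (- w) = 0"
    unfolding pair_force_cnj by (simp add: algebra_simps)
  have "Im w \<noteq> 0"
  proof
    \<comment> \<open>The reflection would fix the vortex \<open>k\<close>, which would collide with \<open>l\<close>.\<close>
    assume "Im w = 0"
    then have "?z p * cnj (?z k) = ?z p * cnj (?z l)"
      unfolding l by (simp add: w_def[symmetric] complex_eq_iff)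
    then have "?z k = ?z l"
      using unit[of p] by auto
    with inj_vortex_position assms(2,4) show False
      by (auto simp: vortex_configuration_def dest: injD)
  qed
  with at_p at_q show ?thesis
    using pair_force_antipodal_nonzero by force
qed

end
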